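(* Let $n\geq 1$ and let $\theta$ be a reflexive and transitive binary relation on $\{1,2,\ldots,n\}$. Let $R$ be a Lie nilpotent ring such that $\mathbb{Z}\smallsetminus\{0\}\subseteq U(R)$ (that is, for every nonzero integer $k$ the element $k\cdot 1_R$ is invertible in $R$). If $A\in M_{n}(\theta,R)$ is invertible in $M_{n}(R)$, then $A^{-1}\in M_{n}(\theta,R)$.
   Context: All rings are associative with identity (not necessarily commutative). $U(R)$ denotes the group of units of $R$ and $M_n(R)$ the ring of $n\times n$ matrices over $R$. For a reflexive and transitive relation $\theta$ on $\{1,\ldots,n\}$, the structural matrix ring is the subring $M_{n}(\theta,R)=\{[a_{i,j}]\in M_{n}(R)\mid a_{i,j}=0\text{ if }(i,j)\notin\theta\}$ of $M_n(R)$. A ring $R$ is Lie nilpotent if for some integer $m\geq 1$ it satisfies the identity $[[[\ldots[[x_{1},x_{2}],x_{3}],\ldots],x_{m}],x_{m+1}]=0$, where $[x,y]=xy-yx$. *)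

theory Defs
  imports "Jordan_Normal_Form.Matrix"
begin

text \<open>
  Rings are types of sort \<open>{ring, monoid_mult}\<close>: associative, with identity, not
  necessarily commutative.  Unlike \<open>ring_1\<close>, this sort does not exclude the zero ring.
\<close>

text \<open>\<open>of_int\<close> needs the class \<open>ring_1\<close>; the lemma below shows the agreement there.\<close>

definition int_in_ring :: "int \<Rightarrow> 'a :: {ring, monoid_mult}" where
  "int_in_ring k = (if 0 \<le> k then (\<Sum>i<nat k. 1) else - (\<Sum>i<nat (- k). 1))"

lemma int_in_ring_eq_of_int: "(int_in_ring k :: 'a :: ring_1) = of_int k"
proof (cases "0 \<le> k")
  case True
  then show ?thesis by (simp add: int_in_ring_def)
next
  case False
  then have "of_nat (nat (- k)) = (of_int (- k) :: 'a)"
    by (intro of_nat_nat) simp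
  with False show ?thesis by (simp add: int_in_ring_def)
qed

definition ring_units :: "'a :: monoid_mult set" where
  "ring_units = {u. \<exists>v. u * v = 1 \<and> v * u = 1}"

definition lie_bracket :: "'a :: ring \<Rightarrow> 'a \<Rightarrow> 'a" where
  "lie_bracket x y = x * y - y * x"

text \<open>With \<open>xs = [x\<^sub>2, \<dots>, x\<^sub>m\<^sub>+\<^sub>1]\<close>, the fold below is the left-normed
  commutator \<open>[\<dots>[[x\<^sub>1, x\<^sub>2], x\<^sub>3], \<dots>, x\<^sub>m\<^sub>+\<^sub>1]\<close>.\<close>

definition lie_nilpotent :: "'a :: ring itself \<Rightarrow> bool" where
  "lie_nilpotent _ \<longleftrightarrow>
     (\<exists>m\<ge>1. \<forall>(x\<^sub>1 :: 'a) xs. length xs = m \<longrightarrow> foldl lie_bracket x\<^sub>1 xs = 0)"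

text \<open>Matrix indices, and hence the relation \<open>\<theta>\<close>, range over \<open>{0..<n}\<close> instead of
  \<open>{1, \<dots>, n}\<close>.\<close>

definition structural_mat :: "nat \<Rightarrow> (nat \<times> nat) set \<Rightarrow> 'a :: zero mat set" where
  "structural_mat n \<theta> =
     {A \<in> carrier_mat n n. \<forall>i<n. \<forall>j<n. (i, j) \<notin> \<theta> \<longrightarrow> A $$ (i, j) = 0}"

text \<open>The library's \<open>inverts_mat\<close> is restricted to \<open>semiring_1\<close>, which excludes the
  zero ring.\<close>

definition mat_inverse_of :: "nat \<Rightarrow> 'a :: {ring, monoid_mult} mat \<Rightarrow> 'a mat \<Rightarrow> bool" where
  "mat_inverse_of n A B \<longleftrightarrow>
     A \<in> carrier_mat n n \<and> B \<in> carrier_mat n n \<and> A * B = 1\<^sub>m n \<and> B * A = 1\<^sub>m n"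

end

theory Submission
  imports Defs "Jordan_Normal_Form.Determinant"
begin

text \<open>
  The theorem reduces to an injectivity statement over Lie nilpotent rings: if square matrices
  satisfy \<open>P X = 1\<close>, then \<open>P v = 0\<close> forces \<open>v = 0\<close>
  (\<open>right_invertible_imp_injective\<close>).  Suppose this is known and let \<open>(i, j) \<notin> \<theta>\<close>.  By
  transitivity, the rows of \<open>A\<close> with index in \<open>U = {k. (i, k) \<in> \<theta>}\<close> vanish outside the
  columns \<open>U\<close>, so \<open>A B = 1\<close> restricts to \<open>A\<^sub>U\<^sub>U B\<^sub>U\<^sub>U = 1\<close>, and \<open>A\<^sub>U\<^sub>U\<close> annihilates the
  \<open>U\<close>-part of column \<open>j\<close> of \<open>B\<close>, because \<open>j \<notin> U\<close>.  Hence that part is zero, and reflexivity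
  places the entry \<open>(i, j)\<close> in it.

  Injectivity is clear over a commutative ring, by determinants.  In general let \<open>D\<close> be the ideal
  generated by all commutators.  The determinant argument in the commutative ring \<open>R / D\<close> shows
  that \<open>F = 1 - X P\<close> has all entries in \<open>D\<close> (\<open>right_inverse_is_left_inverse_mod_commutators\<close>),
  and \<open>P v = 0\<close> gives \<open>v = F v\<close>.  Lie nilpotence makes \<open>D\<close> a nil ideal
  (\<open>commutator_ideal_nil\<close>), so every \<open>1 - d\<close> with \<open>d \<in> D\<close> has a left inverse, and eliminating
  the coordinates of \<open>v\<close> one after the other, as in the proof of Nakayama's lemma, gives
  \<open>v = 0\<close> (\<open>nakayama_elimination\<close>).

  That \<open>D\<close> is nil is seen along the lower central series.  Modulo commutators of length
  \<open>j + 2\<close>, a commutator \<open>c = [u, v]\<close> of length \<open>j + 1\<close> is central, and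
  \<open>[u, v u] = c u\<close> is central too; expanding \<open>[c u, v] = c [u, v] + [c, v] u\<close> shows that
  \<open>c\<^sup>2\<close> vanishes.  So the ideal of commutators of length \<open>j + 1\<close> is generated by central
  elements of square zero modulo the next ideal, hence nil modulo it, and the series reaches
  zero after finitely many steps.
\<close>

section \<open>Two-sided ideals\<close>

definition two_sided_ideal :: "'a :: ring set \<Rightarrow> bool" where
  "two_sided_ideal I \<longleftrightarrow> 0 \<in> I \<and> (\<forall>x\<in>I. \<forall>y\<in>I. x + y \<in> I) \<and>
     (\<forall>x\<in>I. \<forall>r. r * x \<in> I \<and> x * r \<in> I) \<and> (\<forall>x\<in>I. - x \<in> I)"

lemma two_sided_idealD:
  assumes "two_sided_ideal I"
  shows "0 \<in> I" "x \<in> I \<Longrightarrow> y \<in> I \<Longrightarrow> x + y \<in> I" "x \<in> I \<Longrightarrow> r * x \<in> I" "x \<in> I \<Longrightarrow> x * r \<in> I"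
    "x \<in> I \<Longrightarrow> - x \<in> I" "x \<in> I \<Longrightarrow> y \<in> I \<Longrightarrow> x - y \<in> I"
  using assms unfolding two_sided_ideal_def
  by (blast, blast, blast, blast, blast, metis add_uminus_conv_diff)

inductive_set generated_ideal :: "'a :: ring set \<Rightarrow> 'a set" for S where
  zero: "0 \<in> generated_ideal S"
| generator: "c \<in> S \<Longrightarrow> r * c * s \<in> generated_ideal S"
| add: "x \<in> generated_ideal S \<Longrightarrow> y \<in> generated_ideal S \<Longrightarrow> x + y \<in> generated_ideal S"

lemma generated_ideal_mult:
  assumes "x \<in> generated_ideal S"
  shows "t * x * r \<in> generated_ideal S" "t * x \<in> generated_ideal S" "x * r \<in> generated_ideal S"
    "- x \<in> generated_ideal S"
proof -
  show "t * x * r \<in> generated_ideal S" using assms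
  proof (induction rule: generated_ideal.induct)
    case (generator c r' s)
    then show ?case using generated_ideal.generator[of c S "t * r'" "s * r"] by (simp add: mult.assoc)
  qed (auto simp: algebra_simps intro: generated_ideal.intros)
  show "t * x \<in> generated_ideal S" using assms
  proof (induction rule: generated_ideal.induct)
    case (generator c r' s)
    then show ?case using generated_ideal.generator[of c S "t * r'" s] by (simp add: mult.assoc)
  qed (auto simp: algebra_simps intro: generated_ideal.intros)
  show "x * r \<in> generated_ideal S" using assms
  proof (induction rule: generated_ideal.induct)
    case (generator c r' s)
    then show ?case using generated_ideal.generator[of c S r' "s * r"] by (simp add: mult.assoc)
  qed (auto simp: algebra_simps intro: generated_ideal.intros)
  show "- x \<in> generated_ideal S" using assms
  proof (induction rule: generated_ideal.induct)
    case (generator c r' s)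
    then show ?case using generated_ideal.generator[of c S "- r'" s] by simp
  next
    case (add x y)
    then show ?case using generated_ideal.add[of "- x" S "- y"] by simp
  qed (auto intro: generated_ideal.intros)
qed

lemma two_sided_ideal_generated: "two_sided_ideal (generated_ideal S)"
  unfolding two_sided_ideal_def
  by (auto intro: generated_ideal.zero generated_ideal.add generated_ideal_mult)

lemma generator_in_generated_ideal:
  fixes c :: "'a :: {ring, monoid_mult}"
  shows "c \<in> S \<Longrightarrow> c \<in> generated_ideal S"
  using generated_ideal.generator[of c S 1 1] by simp

lemma power_cong_mod_ideal:
  fixes a b :: "'a :: {ring, monoid_mult}"
  assumes I: "two_sided_ideal I" and "a - b \<in> I"
  shows "a ^ k - b ^ k \<in> I"
proof (induction k)
  case 0
  then show ?case using two_sided_idealD(1)[OF I] by simp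
next
  case (Suc k)
  have "a ^ Suc k - b ^ Suc k = a * (a ^ k - b ^ k) + (a - b) * b ^ k"
    by (simp add: algebra_simps)
  then show ?case using Suc assms two_sided_idealD[OF I] by metis
qed

section \<open>The commutator ideal of a Lie nilpotent ring is nil\<close>

text \<open>The induction needs a statement stable under addition: adding an element of the generated
  ideal to any element nilpotent modulo \<open>I\<close> keeps it nilpotent modulo \<open>I\<close>.  For a summand
  \<open>r c s\<close> this holds because a power of the sum falls into \<open>c R + I\<close>, whose elements have square
  in \<open>I\<close>.\<close>

lemma central_square_zero_generators_imp_nil:
  fixes I :: "'a :: {ring, monoid_mult} set"
  assumes I: "two_sided_ideal I"
    and central: "\<And>c w. c \<in> S \<Longrightarrow> c * w - w * c \<in> I"
    and square: "\<And>c. c \<in> S \<Longrightarrow> c * c \<in> I"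
    and x: "x \<in> generated_ideal S"
  shows "\<exists>k. x ^ k \<in> I"
proof -
  note id = two_sided_idealD[OF I]
  have "\<exists>k. (x + y) ^ k \<in> I" if "\<exists>k. y ^ k \<in> I" for y
    using x that
  proof (induction arbitrary: y rule: generated_ideal.induct)
    case zero
    then show ?case by simp
  next
    case (add x1 x2)
    then show ?case by (metis add.assoc)
  next
    case (generator c r s)
    obtain k where k: "y ^ k \<in> I" using generator.prems by blast
    define T where "T = {c * z + i | z i. i \<in> I}"
    have TI: "c * z + i \<in> T" if "i \<in> I" for z i using that T_def by blast
    have swap: "t * c * z - c * t * z \<in> I" for t z
      using id(5)[OF id(4)[OF central[OF generator.hyps, of t], of z]] by (simp add: algebra_simps)
    have T: "two_sided_ideal T"
      unfolding two_sided_ideal_def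
    proof (intro conjI ballI allI)
      show "0 \<in> T" using TI[OF id(1), of 0] by simp
    next
      fix a b assume "a \<in> T" "b \<in> T"
      then obtain z i z' i' where "a = c * z + i" "i \<in> I" "b = c * z' + i'" "i' \<in> I"
        by (auto simp: T_def)
      then show "a + b \<in> T" using TI[OF id(2)[of i i'], of "z + z'"] by (simp add: algebra_simps)
    next
      fix a t assume "a \<in> T"
      then obtain z i where a: "a = c * z + i" "i \<in> I" by (auto simp: T_def)
      have "t * a = c * (t * z) + ((t * c * z - c * t * z) + t * i)"
        using a by (simp add: algebra_simps)
      then show "t * a \<in> T" using TI swap id(2,3) a by metis
      have "a * t = c * (z * t) + i * t" using a by (simp add: algebra_simps)
      then show "a * t \<in> T" using TI id(4) a by metis
    next
      fix a assume "a \<in> T"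
      then obtain z i where "a = c * z + i" "i \<in> I" by (auto simp: T_def)
      then show "- a \<in> T" using TI[OF id(5)[of i], of "- z"] by (simp add: algebra_simps)
    qed
    have "c * 1 + 0 \<in> T" by (rule TI) (rule id)
    then have "r * c * s \<in> T" using two_sided_idealD(3,4)[OF T] by simp
    then have "(r * c * s + y) ^ k - y ^ k \<in> T"
      using power_cong_mod_ideal[OF T, of "r * c * s + y" y k] by simp
    then obtain z i where "(r * c * s + y) ^ k - y ^ k = c * z + i" "i \<in> I"
      by (auto simp: T_def)
    then obtain i where i: "(r * c * s + y) ^ k = c * z + i" "i \<in> I"
      using id(2)[OF _ k] by (metis add.assoc diff_add_cancel)
    have "(c * z + i) * (c * z + i) =
        (c * (z * c * z - c * z * z) + c * c * (z * z)) + (c * z * i + i * (c * z + i))"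
      by (simp add: algebra_simps)
    also have "\<dots> \<in> I"
      using id(2,3,4) swap square[OF generator.hyps] i(2) by meson
    finally have "(r * c * s + y) ^ (k + k) \<in> I" by (simp add: power_add i)
    then show ?case by blast
  qed
  from this[of 0] show ?thesis using id(1) by (metis add_0_right power_one_right)
qed

definition commutator_values :: "nat \<Rightarrow> 'a :: ring set" where
  "commutator_values j = {foldl lie_bracket x xs | x xs. length xs = j}"

lemma lie_bracket_commutator_value:
  "c \<in> commutator_values j \<Longrightarrow> lie_bracket c w \<in> commutator_values (Suc j)"
proof -
  assume "c \<in> commutator_values j"
  then obtain x xs where "c = foldl lie_bracket x xs" "length xs = j"
    by (auto simp: commutator_values_def)
  then have "lie_bracket c w = foldl lie_bracket x (xs @ [w])" "length (xs @ [w]) = Suc j" by auto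
  then show ?thesis unfolding commutator_values_def by blast
qed

lemma commutator_values_SucE:
  assumes "c \<in> commutator_values (Suc j)"
  obtains u v where "u \<in> commutator_values j" "c = lie_bracket u v"
proof -
  obtain x xs where c: "c = foldl lie_bracket x xs" "length xs = Suc j"
    using assms by (auto simp: commutator_values_def)
  then obtain ys v where "xs = ys @ [v]" "length ys = j" by (metis length_Suc_conv_rev)
  then show ?thesis using c that[of "foldl lie_bracket x ys" v]
    by (auto simp: commutator_values_def)
qed

lemma commutator_ideal_nil_mod_next:
  fixes x :: "'a :: {ring, monoid_mult}"
  assumes "x \<in> generated_ideal (commutator_values (Suc j))"
  shows "\<exists>k. x ^ k \<in> generated_ideal (commutator_values (Suc (Suc j)))"
proof (rule central_square_zero_generators_imp_nil[OF two_sided_ideal_generated _ _ assms])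
  let ?I = "generated_ideal (commutator_values (Suc (Suc j))) :: 'a set"
  note id = two_sided_idealD[OF two_sided_ideal_generated]
  show central: "c * w - w * c \<in> ?I" if "c \<in> commutator_values (Suc j)" for c w
    using generator_in_generated_ideal[OF lie_bracket_commutator_value[OF that, of w]]
    by (simp add: lie_bracket_def)
  show "c * c \<in> ?I" if c: "c \<in> commutator_values (Suc j)" for c
  proof -
    obtain u v where uv: "u \<in> commutator_values j" "c = u * v - v * u"
      using c by (auto elim: commutator_values_SucE simp: lie_bracket_def)
    \<comment> \<open>\<open>c u = [u, v u]\<close> is again a commutator with the same \<open>u\<close>, hence central modulo the ideal.\<close>
    have "c * u = lie_bracket u (v * u)" by (simp add: uv lie_bracket_def algebra_simps)
    then have "c * u * v - v * (c * u) \<in> ?I"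
      using central lie_bracket_commutator_value[OF uv(1)] by metis
    moreover have "(c * v - v * c) * u \<in> ?I" using central[OF c] id(4) by blast
    moreover have "c * c = (c * u * v - v * (c * u)) - (c * v - v * c) * u"
      by (simp add: uv algebra_simps)
    ultimately show ?thesis using id(6) by metis
  qed
qed

definition commutator_ideal :: "'a :: ring set" where
  "commutator_ideal = generated_ideal (commutator_values 1)"

lemma two_sided_ideal_commutator_ideal: "two_sided_ideal commutator_ideal"
  unfolding commutator_ideal_def by (rule two_sided_ideal_generated)

lemmas commutator_ideal_closed = two_sided_idealD[OF two_sided_ideal_commutator_ideal]

lemma commutator_ideal_nil:
  fixes x :: "'a :: {ring, monoid_mult}"
  assumes "lie_nilpotent TYPE('a)" and "x \<in> commutator_ideal"
  shows "\<exists>k. x ^ k = 0"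
proof -
  have step: "\<exists>k. x ^ k \<in> generated_ideal (commutator_values (Suc j))" for j
  proof (induction j)
    case 0
    then show ?case using assms(2) by (intro exI[of _ 1]) (simp add: commutator_ideal_def)
  next
    case (Suc j)
    then show ?case using commutator_ideal_nil_mod_next by (metis power_mult)
  qed
  obtain m where m: "m \<ge> 1" "\<And>(y :: 'a) ys. length ys = m \<Longrightarrow> foldl lie_bracket y ys = 0"
    using assms(1) unfolding lie_nilpotent_def by blast
  then obtain j where "m = Suc j" by (cases m) auto
  then have vals: "c = 0" if "c \<in> (commutator_values (Suc j) :: 'a set)" for c
    using that m(2) by (auto simp: commutator_values_def)
  have "y = 0" if "y \<in> generated_ideal (commutator_values (Suc j))" for y :: 'a
    using that by induction (auto dest: vals)
  then show ?thesis using step by blast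
qed

section \<open>Elimination over a nil ideal\<close>

lemma one_minus_nilpotent_left_inverse:
  fixes d :: "'a :: {ring, monoid_mult}"
  assumes "d ^ k = 0"
  shows "\<exists>u. u * (1 - d) = 1"
proof -
  have "\<exists>u. u * (1 - d) = 1 - d ^ k"
  proof (induction k)
    case 0
    show ?case by (intro exI[of _ 0]) simp
  next
    case (Suc k)
    then obtain u where "u * (1 - d) = 1 - d ^ k" by blast
    then have "(1 + d * u) * (1 - d) = 1 - d ^ Suc k"
      by (simp add: distrib_right mult.assoc) (simp add: algebra_simps)
    then show ?case by blast
  qed
  then show ?thesis using assms by simp
qed

text \<open>The last equation is solved for the last coordinate, using a left inverse of
  \<open>1 - f n n\<close>; substituting it into the others gives a system of the same kind with one
  unknown fewer, since its coefficients stay in \<open>I\<close>.\<close>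

lemma nakayama_elimination:
  fixes v :: "nat \<Rightarrow> 'a :: {ring, monoid_mult}"
  assumes I: "two_sided_ideal I" and nil: "\<And>x. x \<in> I \<Longrightarrow> \<exists>k. x ^ k = 0"
    and "\<And>i j. i < n \<Longrightarrow> j < n \<Longrightarrow> f i j \<in> I"
    and "\<And>i. i < n \<Longrightarrow> v i = (\<Sum>j<n. f i j * v j)"
    and "i < n"
  shows "v i = 0"
  using assms(3-5)
proof (induction n arbitrary: f i)
  case 0
  then show ?case by simp
next
  case (Suc n)
  note id = two_sided_idealD[OF I]
  obtain u where u: "u * (1 - f n n) = 1"
    using one_minus_nilpotent_left_inverse nil[OF Suc.prems(1)[of n n]] by blast
  have "(1 - f n n) * v n = (\<Sum>j<n. f n j * v j)"
    using Suc.prems(2)[of n] by (simp add: algebra_simps)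
  then have vn: "v n = u * (\<Sum>j<n. f n j * v j)"
    using u by (metis mult.assoc mult_1_left)
  have zero: "v k = 0" if "k < n" for k
  proof (rule Suc.IH[of "\<lambda>i j. f i j + f i n * (u * f n j)", OF _ _ that])
    fix i j assume "i < n" "j < n"
    then show "f i j + f i n * (u * f n j) \<in> I" using Suc.prems(1) id by simp
  next
    fix i assume "i < n"
    then have "v i = (\<Sum>j<n. f i j * v j) + f i n * v n" using Suc.prems(2)[of i] by simp
    then show "v i = (\<Sum>j<n. (f i j + f i n * (u * f n j)) * v j)"
      by (simp add: vn sum_distrib_left distrib_right sum.distrib mult.assoc)
  qed
  then have "v n = 0" using vn by simp
  then show ?case using zero Suc.prems(3) less_Suc_eq by metis
qed

section \<open>Determinants modulo commutators\<close>

lemma right_inverse_is_left_inverse_comm_ring: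
  fixes P X :: "'a :: comm_ring_1 mat"
  assumes P: "P \<in> carrier_mat n n" and X: "X \<in> carrier_mat n n" and PX: "P * X = 1\<^sub>m n"
  shows "X * P = 1\<^sub>m n"
proof -
  note adj = adj_mat[OF P]
  have dets: "det P * det X = 1" using det_mult[OF P X] PX by simp
  have "det P \<cdot>\<^sub>m X = (det P \<cdot>\<^sub>m 1\<^sub>m n) * X" using X by auto
  also have "\<dots> = adj_mat P * (P * X)" using adj P X by (metis assoc_mult_mat)
  also have "\<dots> = adj_mat P" using PX adj by simp
  finally have eq: "det P \<cdot>\<^sub>m (X * P) = det P \<cdot>\<^sub>m 1\<^sub>m n"
    using adj P X by (metis mult_smult_assoc_mat)
  show ?thesis
  proof (rule eq_matI)
    fix i j assume ij: "i < dim_row (1\<^sub>m n :: 'a mat)" "j < dim_col (1\<^sub>m n :: 'a mat)"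
    then have "det P * (X * P) $$ (i, j) = det P * (1\<^sub>m n :: 'a mat) $$ (i, j)"
      using arg_cong[OF eq, of "\<lambda>M. M $$ (i, j)"] P X by (simp del: index_mult_mat(1))
    then have "det X * det P * (X * P) $$ (i, j) = det X * det P * (1\<^sub>m n :: 'a mat) $$ (i, j)"
      by (simp only: mult.assoc)
    then show "(X * P) $$ (i, j) = 1\<^sub>m n $$ (i, j)"
      using dets by (simp only: mult.commute[of "det X"] mult_1_left)
  qed (use P X in auto)
qed

text \<open>The commutative ring \<open>R / D \<times> \<int>\<close>, where \<open>D\<close> is the ideal generated by the commutators.
  The factor \<open>\<int>\<close> keeps \<open>0 \<noteq> 1\<close> when \<open>D\<close> is all of \<open>R\<close>.\<close>

quotient_type (overloaded) 'a abelianized_times_int = "'a :: {ring, monoid_mult} \<times> int" /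
  "\<lambda>p q. fst p - fst q \<in> commutator_ideal \<and> snd p = snd q"
proof (rule equivpI)
  show "reflp (\<lambda>p q :: 'a \<times> int. fst p - fst q \<in> commutator_ideal \<and> snd p = snd q)"
    by (simp add: reflp_def commutator_ideal_closed)
  show "symp (\<lambda>p q :: 'a \<times> int. fst p - fst q \<in> commutator_ideal \<and> snd p = snd q)"
    by (rule sympI) (metis commutator_ideal_closed(5) minus_diff_eq)
  show "transp (\<lambda>p q :: 'a \<times> int. fst p - fst q \<in> commutator_ideal \<and> snd p = snd q)"
    by (rule transpI) (metis commutator_ideal_closed(2) diff_add_cancel add_diff_eq)
qed

lemma commutator_in_commutator_ideal:
  "(x :: 'a :: {ring, monoid_mult}) * y - y * x \<in> commutator_ideal"
proof -
  have "x \<in> commutator_values 0" by (simp add: commutator_values_def)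
  from generator_in_generated_ideal[OF lie_bracket_commutator_value[OF this, of y]]
  show ?thesis by (simp add: lie_bracket_def commutator_ideal_def)
qed

instantiation abelianized_times_int :: ("{ring, monoid_mult}") comm_ring_1
begin

lift_definition zero_abelianized_times_int :: "'a abelianized_times_int" is "(0, 0)" .
lift_definition one_abelianized_times_int :: "'a abelianized_times_int" is "(1, 1)" .

lift_definition plus_abelianized_times_int ::
  "'a abelianized_times_int \<Rightarrow> 'a abelianized_times_int \<Rightarrow> 'a abelianized_times_int"
  is "\<lambda>p q. (fst p + fst q, snd p + snd q)"
  by (simp add: add_diff_add commutator_ideal_closed(2))

lift_definition uminus_abelianized_times_int ::
  "'a abelianized_times_int \<Rightarrow> 'a abelianized_times_int"
  is "\<lambda>p. (- fst p, - snd p)"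
  by (simp, metis commutator_ideal_closed(5) minus_diff_eq minus_diff_minus)

lift_definition minus_abelianized_times_int ::
  "'a abelianized_times_int \<Rightarrow> 'a abelianized_times_int \<Rightarrow> 'a abelianized_times_int"
  is "\<lambda>p q. (fst p - fst q, snd p - snd q)"
proof -
  fix p p' q q' :: "'a \<times> int"
  assume "fst p - fst p' \<in> commutator_ideal \<and> snd p = snd p'"
    and "fst q - fst q' \<in> commutator_ideal \<and> snd q = snd q'"
  then show "fst (fst p - fst q, snd p - snd q) - fst (fst p' - fst q', snd p' - snd q')
      \<in> commutator_ideal \<and>
      snd (fst p - fst q, snd p - snd q) = snd (fst p' - fst q', snd p' - snd q')"
    using commutator_ideal_closed(6)[of "fst p - fst p'" "fst q - fst q'"]
    by (simp add: algebra_simps)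
qed

lift_definition times_abelianized_times_int ::
  "'a abelianized_times_int \<Rightarrow> 'a abelianized_times_int \<Rightarrow> 'a abelianized_times_int"
  is "\<lambda>p q. (fst p * fst q, snd p * snd q)"
proof -
  fix p p' q q' :: "'a \<times> int"
  assume "fst p - fst p' \<in> commutator_ideal \<and> snd p = snd p'"
    and "fst q - fst q' \<in> commutator_ideal \<and> snd q = snd q'"
  moreover have "fst p * fst q - fst p' * fst q' =
      (fst p - fst p') * fst q + fst p' * (fst q - fst q')"
    by (simp add: algebra_simps)
  ultimately show "fst (fst p * fst q, snd p * snd q) - fst (fst p' * fst q', snd p' * snd q')
      \<in> commutator_ideal \<and>
      snd (fst p * fst q, snd p * snd q) = snd (fst p' * fst q', snd p' * snd q')"
    by (simp add: commutator_ideal_closed)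
qed

instance
proof
  note [simp] = commutator_ideal_closed(1)
  fix a b c :: "'a abelianized_times_int"
  show "a * b * c = a * (b * c)" by transfer (simp add: algebra_simps)
  show "a * b = b * a" by transfer (simp add: commutator_in_commutator_ideal)
  show "1 * a = a" by transfer simp
  show "a + b + c = a + (b + c)" by transfer (simp add: algebra_simps)
  show "a + b = b + a" by transfer (simp add: algebra_simps)
  show "0 + a = a" by transfer simp
  show "- a + a = 0" by transfer simp
  show "a - b = a + - b" by transfer simp
  show "(a + b) * c = a * c + b * c" by transfer (simp add: algebra_simps)
  show "(0 :: 'a abelianized_times_int) \<noteq> 1" by transfer simp
qed

end

lift_definition abelianize :: "'a :: {ring, monoid_mult} \<Rightarrow> int \<Rightarrow> 'a abelianized_times_int"
  is Pair .

lemma abelianize_simps: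
  "abelianize x m * abelianize y k = abelianize (x * y) (m * k)"
  "abelianize x m + abelianize y k = abelianize (x + y) (m + k)"
  "abelianize 0 0 = 0" "abelianize 1 1 = 1"
  by (transfer; simp add: commutator_ideal_closed)+

lemma abelianize_eqD: "abelianize x m = abelianize y k \<Longrightarrow> x - y \<in> commutator_ideal"
  by transfer simp

lemma abelianize_sum:
  "(\<Sum>k\<in>K. abelianize (f k) (g k)) = abelianize (\<Sum>k\<in>K. f k) (\<Sum>k\<in>K. g k)"
  by (induction K rule: infinite_finite_induct) (auto simp: abelianize_simps)

text \<open>The matrices are read in \<open>R / D \<times> \<int>\<close> with the identity matrix as integer component, so
  that the identity matrix over \<open>R\<close> becomes the identity matrix.\<close>

lemma right_inverse_is_left_inverse_mod_commutators:
  fixes p x :: "nat \<Rightarrow> nat \<Rightarrow> 'a :: {ring, monoid_mult}"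
  assumes px: "\<And>i j. i < n \<Longrightarrow> j < n \<Longrightarrow> (\<Sum>k<n. p i k * x k j) = (if i = j then 1 else 0)"
    and "i < n" "j < n"
  shows "(if i = j then 1 else 0) - (\<Sum>k<n. x i k * p k j) \<in> commutator_ideal"
proof -
  define M where "M q = mat n n (\<lambda>(i, j). abelianize (q i j) (if i = j then 1 else 0))"
    for q :: "nat \<Rightarrow> nat \<Rightarrow> 'a"
  have delta: "(\<Sum>k<n. (if i = k then 1 else 0) * (if k = j then 1 else 0)) =
      (if i = j then 1 else 0 :: int)" if "i < n" for i j
  proof -
    have "(\<Sum>k<n. (if i = k then 1 else 0) * (if k = j then 1 else 0)) =
      (\<Sum>k<n. if k = i then (if i = j then 1 else 0 :: int) else 0)"
      by (rule sum.cong) auto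
    then show ?thesis using that by simp
  qed
  have entry: "(M q * M r) $$ (i, j) = abelianize (\<Sum>k<n. q i k * r k j) (if i = j then 1 else 0)"
    if "i < n" "j < n" for q r i j
  proof -
    have "(M q * M r) $$ (i, j) = (\<Sum>k<n. abelianize (q i k * r k j)
        ((if i = k then 1 else 0) * (if k = j then 1 else 0)))"
      using that by (simp add: M_def scalar_prod_def abelianize_simps atLeast0LessThan)
    also have "\<dots> = abelianize (\<Sum>k<n. q i k * r k j)
        (\<Sum>k<n. (if i = k then 1 else 0) * (if k = j then 1 else 0))"
      by (rule abelianize_sum)
    finally show ?thesis using delta[OF that(1)] by simp
  qed
  have one: "abelianize (if i = j then 1 else 0) (if i = j then 1 else 0) =
      (if i = j then 1 else 0 :: 'a abelianized_times_int)" for i j :: nat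
    by (simp add: abelianize_simps)
  have M: "M q \<in> carrier_mat n n" for q by (simp add: M_def)
  have "M p * M x = 1\<^sub>m n"
  proof (rule eq_matI)
    fix i j assume "i < dim_row (1\<^sub>m n :: 'a abelianized_times_int mat)"
      "j < dim_col (1\<^sub>m n :: 'a abelianized_times_int mat)"
    then show "(M p * M x) $$ (i, j) = 1\<^sub>m n $$ (i, j)"
      using entry[of i j] px[of i j] one[of i j] by simp
  qed (simp_all add: M_def)
  from right_inverse_is_left_inverse_comm_ring[OF M M this]
  have "abelianize (if i = j then 1 else 0) (if i = j then 1 else 0) =
      abelianize (\<Sum>k<n. x i k * p k j) (if i = j then 1 else 0)"
    using entry[OF assms(2,3), of x p] one[of i j] assms(2,3) by simp
  then show ?thesis by (rule abelianize_eqD)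
qed

section \<open>Inverses of structural matrices\<close>

text \<open>\<open>P v = 0\<close> makes \<open>v\<close> a fixed vector of \<open>1 - X P\<close>, whose entries lie in the commutator
  ideal.\<close>

lemma right_invertible_imp_injective:
  fixes p x :: "nat \<Rightarrow> nat \<Rightarrow> 'a :: {ring, monoid_mult}"
  assumes lie: "lie_nilpotent TYPE('a)"
    and px: "\<And>i j. i < n \<Longrightarrow> j < n \<Longrightarrow> (\<Sum>k<n. p i k * x k j) = (if i = j then 1 else 0)"
    and kernel: "\<And>i. i < n \<Longrightarrow> (\<Sum>k<n. p i k * v k) = 0"
    and "i < n"
  shows "v i = 0"
proof -
  let ?f = "\<lambda>i j. (if i = j then 1 else 0) - (\<Sum>k<n. x i k * p k j)"
  show ?thesis
  proof (rule nakayama_elimination[where f = ?f and v = v, OF two_sided_ideal_commutator_ideal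
        commutator_ideal_nil[OF lie] _ _ \<open>i < n\<close>])
    fix i assume i: "i < n"
    show "?f i j \<in> commutator_ideal" if "j < n" for j
      by (rule right_inverse_is_left_inverse_mod_commutators[OF px i that])
    have "(\<Sum>j<n. (\<Sum>k<n. x i k * p k j) * v j) = (\<Sum>j<n. \<Sum>k<n. x i k * (p k j * v j))"
      by (simp add: sum_distrib_right mult.assoc)
    also have "\<dots> = (\<Sum>k<n. \<Sum>j<n. x i k * (p k j * v j))" by (rule sum.swap)
    also have "\<dots> = (\<Sum>k<n. x i k * (\<Sum>j<n. p k j * v j))" by (simp add: sum_distrib_left)
    also have "\<dots> = 0" using kernel by simp
    finally have "(\<Sum>j<n. (\<Sum>k<n. x i k * p k j) * v j) = 0" .
    moreover have "(\<Sum>j<n. (if i = j then 1 else 0) * v j) = v i"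
    proof -
      have "(\<Sum>j<n. (if i = j then 1 else 0) * v j) = (\<Sum>j<n. if j = i then v i else 0)"
        by (rule sum.cong) auto
      then show ?thesis using i by simp
    qed
    ultimately show "v i = (\<Sum>j<n. ?f i j * v j)" by (simp add: left_diff_distrib sum_subtractf)
  qed
qed

theorem theorem3p2:
  fixes n :: nat and \<theta> :: "(nat \<times> nat) set" and A B :: "'a :: {ring, monoid_mult} mat"
  assumes "n \<ge> 1"
    and "\<theta> \<subseteq> {0..<n} \<times> {0..<n}" and "refl_on {0..<n} \<theta>" and "trans \<theta>"
    and "lie_nilpotent TYPE('a)"
    and "\<And>k :: int. k \<noteq> 0 \<Longrightarrow> (int_in_ring k :: 'a) \<in> ring_units"
    and "A \<in> structural_mat n \<theta>"
    and "mat_inverse_of n A B"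
  shows "B \<in> structural_mat n \<theta>"
proof -
  have A: "A \<in> carrier_mat n n" and B: "B \<in> carrier_mat n n" and AB: "A * B = 1\<^sub>m n"
    using assms(8) by (auto simp: mat_inverse_of_def)
  have prod: "(\<Sum>k<n. A $$ (i, k) * B $$ (k, j)) = (if i = j then 1 else 0)"
    if "i < n" "j < n" for i j
  proof -
    have "(A * B) $$ (i, j) = (\<Sum>k<n. A $$ (i, k) * B $$ (k, j))"
      using that A B by (simp add: scalar_prod_def atLeast0LessThan)
    then show ?thesis using that AB by simp
  qed
  have "B $$ (r, c) = 0" if rc: "r < n" "c < n" "(r, c) \<notin> \<theta>" for r c
  proof -
    define U where "U = {k. (r, k) \<in> \<theta>}"
    have "r \<in> U" "c \<notin> U" using rc assms(3) by (auto simp: U_def refl_on_def)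
    have A0: "A $$ (i, k) = 0" if "i \<in> U" "k \<notin> U" "i < n" "k < n" for i k
    proof -
      have "(i, k) \<notin> \<theta>" using that(1,2) assms(4) unfolding U_def by (blast dest: transD)
      then show ?thesis using that(3,4) assms(7) by (simp add: structural_mat_def)
    qed
    \<comment> \<open>The diagonal blocks with indices in \<open>U\<close>, extended by the identity outside \<open>U\<close>; this keeps
      the size \<open>n\<close>.\<close>
    define ext where "ext Q i j =
        (if i \<in> U \<and> j \<in> U then Q $$ (i, j) else if i = j then 1 else 0)"
      for Q :: "'a mat" and i j
    define v where "v k = (if k \<in> U then B $$ (k, c) else 0)" for k
    have outside: "(\<Sum>k<n. ext A i k * f k) = f i" if "i \<notin> U" "i < n" for i f
    proof -
      have "(\<Sum>k<n. ext A i k * f k) = (\<Sum>k<n. if k = i then f i else 0)"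
        using that by (intro sum.cong) (auto simp: ext_def)
      then show ?thesis using that by simp
    qed
    have inside: "(\<Sum>k<n. ext A i k * f k) = (if i = j then 1 else 0)"
      if "i \<in> U" "i < n" "j < n" "\<And>k. k \<in> U \<Longrightarrow> f k = B $$ (k, j)" for i j f
    proof -
      have "(\<Sum>k<n. ext A i k * f k) = (\<Sum>k<n. A $$ (i, k) * B $$ (k, j))"
        using that A0 by (intro sum.cong) (auto simp: ext_def)
      then show ?thesis using prod that by simp
    qed
    have "v r = 0"
    proof (rule right_invertible_imp_injective[OF assms(5), of n "ext A" "ext B"])
      show "r < n" by fact
      fix i assume i: "i < n"
      show "(\<Sum>k<n. ext A i k * v k) = 0"
        using inside[of i c v] outside[of i v] i rc(2) \<open>c \<notin> U\<close> by (cases "i \<in> U") (auto simp: v_def)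
      fix j assume j: "j < n"
      consider "i \<notin> U" | "i \<in> U" "j \<in> U" | "i \<in> U" "j \<notin> U" by blast
      then show "(\<Sum>k<n. ext A i k * ext B k j) = (if i = j then 1 else 0)"
      proof cases
        case 1
        then show ?thesis using outside[of i "\<lambda>k. ext B k j"] i by (simp add: ext_def)
      next
        case 2
        then show ?thesis using inside[of i j "\<lambda>k. ext B k j"] i j by (simp add: ext_def)
      next
        case 3
        then have "ext A i k * ext B k j = 0" for k by (auto simp: ext_def)
        then show ?thesis using 3 by auto
      qed
    qed
    then show ?thesis using \<open>r \<in> U\<close> by (simp add: v_def)
  qed
  then show ?thesis using B by (simp add: structural_mat_def)
qed

end
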